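(* Let $\mathbb{F}_q$ be any finite field and let $p$ be its characteristic. For every integer $n\ge 1$, $$\sum_{a\in\mathbb{F}_p^{\ast}} |S_a(n)|-(p-1)\,|S_0(n)|=\begin{cases}0, & \text{if } p\nmid n,\\ \sum_{a\in\mathbb{F}_p^{\ast}}|S_a(n/p)|, & \text{if } p\mid n.\end{cases}$$
   Context: $\mathcal{I}_q^n$ denotes the set of monic irreducible polynomials of degree $n$ in $\mathbb{F}_q[x]$. For $f\in\mathcal{I}_q^n$ with root $\alpha\in\mathbb{F}_{q^n}$, define $\operatorname{Tr}(f):=\operatorname{Tr}_{q^n/p}(\alpha)\in\mathbb{F}_p$, where $\operatorname{Tr}_{q^n/p}:\mathbb{F}_{q^n}\to\mathbb{F}_p$ is the absolute trace (this does not depend on the chosen root; if $f=x^n+\sum_{i=0}^{n-1}a_ix^i$, then $\operatorname{Tr}(f)=-\operatorname{Tr}_{q/p}(a_{n-1})$). For $a\in\mathbb{F}_p$ and $n\ge 1$, $S_a(n):=\{f\in\mathcal{I}_q^n\mid \operatorname{Tr}(f)=a\}$. *)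

theory Defs
  imports "HOL-Algebra.Algebraic_Closure_Type" "HOL-Library.Cardinality" "HOL-Number_Theory.Cong"
begin

hide_const (open) Polynomials.degree Polynomials.lead_coeff Divisibility.irreducible

definition prime_subfield :: "'a::semiring_1 set" where
  "prime_subfield = range of_nat"

text \<open>The degree of \<open>\<F>\<^sub>q\<close> over \<open>\<F>\<^sub>p\<close>, that is, the \<open>m\<close> with \<open>q = p ^ m\<close>.\<close>
definition prime_degree :: "'a::finite_field itself \<Rightarrow> nat" where
  "prime_degree _ = (THE m. CARD('a) = CHAR('a) ^ m)"

text \<open>
  The absolute trace from the field with \<open>p ^ N\<close> elements, which sits inside an algebraically
  closed field of characteristic \<open>p\<close> as the set of solutions of \<open>x ^ (p ^ N) = x\<close>, is the sum
  of the \<open>N\<close> conjugates over the prime field.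
\<close>
definition abs_trace :: "nat \<Rightarrow> 'b::field \<Rightarrow> 'b" where
  "abs_trace N x = (\<Sum>i<N. x ^ (CHAR('b) ^ i))"

text \<open>
  Here \<open>q ^ n = p ^ (m * n)\<close> for \<open>n = degree f\<close> and \<open>m\<close> the degree of \<open>\<F>\<^sub>q\<close> over \<open>\<F>\<^sub>p\<close>. The lemmas
  \<open>root_in_extension\<close> and \<open>poly_trace_eq\<close> below show that the roots of an irreducible \<open>f\<close> lie in
  the field with \<open>q ^ n\<close> elements and that the choice of the root is irrelevant.
\<close>
definition poly_trace :: "'a::finite_field poly \<Rightarrow> 'a alg_closure" where
  "poly_trace f = abs_trace (prime_degree TYPE('a) * degree f)
                    (SOME \<alpha>. poly (map_poly to_ac f) \<alpha> = 0)"

definition monic_irreducibles :: "nat \<Rightarrow> 'a::finite_field poly set" where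
  "monic_irreducibles n = {f. lead_coeff f = 1 \<and> irreducible f \<and> degree f = n}"

definition S :: "'a::finite_field \<Rightarrow> nat \<Rightarrow> 'a poly set" where
  "S a n = {f \<in> monic_irreducibles n. poly_trace f = to_ac a}"


lemma card_prime_power:
  "\<exists>m. CARD('a::finite_field) = CHAR('a) ^ m"
proof -
  define p where "p = CHAR('a)"
  have p: "prime p" by (simp add: p_def)
  define P where "P = (\<lambda>A :: 'a set. 0 \<in> A \<and> (\<forall>x\<in>A. \<forall>y\<in>A. x + y \<in> A) \<and> (\<exists>m. card A = p ^ m))"
  have P0: "P {0}" unfolding P_def by (auto intro: exI[of _ 0])
  have bdd: "\<forall>A. P A \<longrightarrow> card A < Suc (CARD('a))"
    by (simp add: card_mono le_imp_less_Suc)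
  obtain A where A: "P A" and max: "\<And>B. P B \<Longrightarrow> card B \<le> card A"
    using ex_has_greatest_nat[of P "{0}" card "Suc CARD('a)"] P0 bdd by blast
  have add: "x + y \<in> A" if "x \<in> A" "y \<in> A" for x y using A that by (auto simp: P_def)
  have zero: "0 \<in> A" using A by (auto simp: P_def)
  have mul: "of_nat k * x \<in> A" if "x \<in> A" for k x
    by (induction k) (auto simp: zero algebra_simps intro: add that)
  have neg: "- x \<in> A" if "x \<in> A" for x
  proof -
    have "of_nat (p - 1) * x = (of_nat p - 1) * x"
      using prime_gt_0_nat[OF p] by (simp add: of_nat_diff)
    also have "\<dots> = - x" by (simp add: p_def)
    finally show ?thesis using mul[OF that, of "p - 1"] by simp
  qed
  have "A = UNIV"
  proof (rule ccontr)
    assume "A \<noteq> UNIV"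
    then obtain x where x: "x \<notin> A" by blast
    define B where "B = (\<lambda>(a, j). a + of_nat j * x) ` (A \<times> {..<p})"
    have key: False if "a \<in> A" "b \<in> A" "i < j" "j < p" "a + of_nat i * x = b + of_nat j * x" for a b i j
    proof -
      have "of_nat (j - i) * x = a + - b"
        using that by (simp add: of_nat_diff algebra_simps)
      hence "of_nat (j - i) * x \<in> A" using that by (metis add neg)
      moreover have "coprime (j - i) p"
        using that p by (metis coprime_commute diff_is_0_eq less_imp_diff_less linorder_not_less
            nat_dvd_not_less neq0_conv prime_imp_coprime)
      then obtain e where "[(j - i) * e = 1] (mod p)"
        using cong_solve_coprime_nat by auto
      hence "of_nat ((j - i) * e) = (of_nat 1 :: 'a)"
        unfolding p_def by (simp only: of_nat_eq_iff_cong_CHAR)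
      hence "of_nat e * of_nat (j - i) = (1::'a)"
        by (metis mult.commute of_nat_1 of_nat_mult)
      ultimately have "x \<in> A" using mul[of "of_nat (j - i) * x" e] by (metis mult.assoc mult_1)
      with x show False by simp
    qed
    have inj: "inj_on (\<lambda>(a, j). a + of_nat j * x) (A \<times> {..<p})"
    proof (rule inj_onI, clarsimp)
      fix a i b j assume h: "a \<in> A" "b \<in> A" "i < p" "j < p" "a + of_nat i * x = b + of_nat j * x"
      have "i = j"
      proof (rule ccontr)
        assume "i \<noteq> j"
        then consider "i < j" | "j < i" by linarith
        thus False using key[of a b i j] key[of b a j i] h by cases auto
      qed
      with h show "a = b \<and> i = j" by simp
    qed
    have cB: "card B = card A * p"
      unfolding B_def using inj by (simp add: card_image card_cartesian_product)
    have modp: "of_nat (k mod p) = (of_nat k :: 'a)" for k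
      unfolding p_def by (subst of_nat_eq_iff_cong_CHAR) (simp add: cong_def)
    have B_iff: "y \<in> B \<longleftrightarrow> (\<exists>a\<in>A. \<exists>k. y = a + of_nat k * x)" for y
    proof
      assume "\<exists>a\<in>A. \<exists>k. y = a + of_nat k * x"
      then obtain a k where ak: "a \<in> A" "y = a + of_nat k * x" by blast
      hence "y = a + of_nat (k mod p) * x" "k mod p < p"
        using modp prime_gt_0_nat[OF p] by auto
      thus "y \<in> B" unfolding B_def using ak(1) by force
    qed (auto simp: B_def)
    have "P B" unfolding P_def
    proof (intro conjI ballI)
      show "0 \<in> B" unfolding B_iff using zero by (intro bexI[of _ 0] exI[of _ 0]) auto
    next
      fix u v assume "u \<in> B" "v \<in> B"
      then obtain a k b l where "a \<in> A" "u = a + of_nat k * x" "b \<in> A" "v = b + of_nat l * x"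
        unfolding B_iff by blast
      thus "u + v \<in> B" unfolding B_iff
        by (intro bexI[of _ "a + b"] exI[of _ "k + l"]) (auto simp: algebra_simps add)
    next
      obtain m where "card A = p ^ m" using A by (auto simp: P_def)
      thus "\<exists>m. card B = p ^ m" unfolding cB by (intro exI[of _ "Suc m"]) simp
    qed
    from max[OF this] have "card A * p \<le> card A" by (simp add: cB)
    moreover have "card A > 0" using zero by (auto simp: card_gt_0_iff)
    ultimately show False using prime_gt_1_nat[OF p] by auto
  qed
  thus ?thesis using A by (auto simp: P_def p_def)
qed

lemma CHAR_power_prime_degree: "CHAR('a) ^ prime_degree TYPE('a::finite_field) = CARD('a)"
proof -
  obtain m where m: "CARD('a) = CHAR('a) ^ m" using card_prime_power by blast
  have "prime_degree TYPE('a) = m" unfolding prime_degree_def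
    by (rule the_equality) (use m prime_gt_1_nat[OF CHAR_prime[where ?'a='a]] in auto)
  thus ?thesis using m by simp
qed

abbreviation (input) ev :: "'a::field poly \<Rightarrow> 'a alg_closure \<Rightarrow> 'a alg_closure" where
  "ev f \<equiv> poly (map_poly to_ac f)"

lemma ev_pCons [simp]: "ev (pCons a f) x = to_ac a + x * ev f x"
  by (simp add: map_poly_pCons)

lemma ev_add [simp]: "ev (f + g) x = ev f x + ev g x"
  by (induction f g rule: poly_induct2) (simp_all add: algebra_simps)

lemma ev_smult [simp]: "ev (smult c f) x = to_ac c * ev f x"
  by (induction f) (simp_all add: algebra_simps)

lemma ev_mult [simp]: "ev (f * g) x = ev f x * ev g x"
  by (induction f) (simp_all add: algebra_simps)

lemma ev_minus [simp]: "ev (- f) x = - ev f x"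
  by (induction f) (simp_all add: algebra_simps)

lemma ev_diff [simp]: "ev (f - g) x = ev f x - ev g x"
  using ev_add[of f "- g" x] by (simp del: ev_add)

lemma ev_sum: "ev (sum h A) x = (\<Sum>i\<in>A. ev (h i) x)"
  by (induction A rule: infinite_finite_induct) simp_all

lemma ev_monom: "ev (monom 1 k) x = x ^ k"
  by (simp add: map_poly_monom poly_monom)

lemma irreducible_dvd_of_common_root:
  fixes f g :: "'a::field poly"
  assumes "irreducible f" "ev f x = 0" "ev g x = 0"
  shows "f dvd g"
proof -
  define P where "P = (\<lambda>h :: 'a poly. h \<noteq> 0 \<and> ev h x = 0)"
  have "P f" using assms by (auto simp: P_def)
  then obtain h where h: "P h" and min: "\<And>k. P k \<Longrightarrow> degree h \<le> degree k"
    using ex_has_least_nat[of P f degree] by blast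
  have dvd: "h dvd k" if "ev k x = 0" for k
  proof -
    have "ev (k mod h) x = 0"
      using h that by (simp add: P_def flip: minus_div_mult_eq_mod)
    moreover have "k mod h = 0 \<or> degree (k mod h) < degree h"
      using h by (intro degree_mod_less) (auto simp: P_def)
    ultimately have "k mod h = 0" using min[of "k mod h"] by (force simp: P_def)
    thus ?thesis by auto
  qed
  obtain k where k: "f = h * k" using dvd[OF assms(2)] by blast
  have "\<not> h dvd 1"
  proof
    assume "h dvd 1"
    then obtain u where "1 = h * u" ..
    hence "ev h x * ev u x = 1" by (simp flip: ev_mult)
    thus False using h by (simp add: P_def)
  qed
  hence "k dvd 1" using irreducibleD[OF assms(1) k] by blast
  hence "f dvd h" using k by (simp add: mult_unit_dvd_iff)
  thus ?thesis using dvd[OF assms(3)] dvd_trans by blast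
qed

lemma root_in_extension:
  fixes f :: "'a::finite_field poly"
  assumes "irreducible f" "ev f x = 0"
  shows "x ^ (CARD('a) ^ degree f) = x"
proof (cases "x = 0")
  case False
  define n where "n = degree f"
  define D where "D = {g :: 'a poly. \<forall>i\<ge>n. coeff g i = 0}"
  have f0: "f \<noteq> 0" using assms by auto
  have D: "D = Poly ` {xs. length xs = n}"
  proof (intro equalityI subsetI)
    fix g assume g: "g \<in> D"
    have "g = Poly (map (coeff g) [0..<n])"
      using g by (intro poly_eqI) (auto simp: D_def nth_default_def)
    thus "g \<in> Poly ` {xs. length xs = n}" by (intro image_eqI) auto
  qed (auto simp: D_def nth_default_def)
  have injP: "inj_on Poly {xs :: 'a list. length xs = n}"
  proof (rule inj_onI)
    fix xs ys :: "'a list" assume h: "xs \<in> {xs. length xs = n}" "ys \<in> {xs. length xs = n}" "Poly xs = Poly ys"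
    have "xs ! i = ys ! i" if "i < n" for i
    proof -
      have "coeff (Poly xs) i = coeff (Poly ys) i" using h by simp
      thus ?thesis using h(1,2) that by (simp add: nth_default_nth)
    qed
    thus "xs = ys" using h by (intro nth_equalityI) auto
  qed
  have "card {xs :: 'a list. length xs = n} = CARD('a) ^ n"
    using card_lists_length_eq[of "UNIV :: 'a set" n] by simp
  hence cD: "card D = CARD('a) ^ n" unfolding D using injP by (simp add: card_image)
  have deg: "degree g < n" if "g \<in> D" "g \<noteq> 0" for g
  proof (rule ccontr)
    assume "\<not> degree g < n"
    hence "lead_coeff g = 0" using that(1) by (simp add: D_def)
    thus False using that(2) by simp
  qed
  have diffD: "g - h \<in> D" if "g \<in> D" "h \<in> D" for g h using that by (auto simp: D_def)
  define K where "K = (\<lambda>g. ev g x) ` D"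
  have zero_iff: "g = 0" if "g \<in> D" "ev g x = 0" for g
  proof (rule ccontr)
    assume "g \<noteq> 0"
    have "f dvd g" by (rule irreducible_dvd_of_common_root[OF assms that(2)])
    hence "n \<le> degree g" unfolding n_def using \<open>g \<noteq> 0\<close> by (rule dvd_imp_degree_le)
    thus False using deg[OF that(1) \<open>g \<noteq> 0\<close>] by simp
  qed
  have "inj_on (\<lambda>g. ev g x) D"
  proof (rule inj_onI)
    fix g h assume h: "g \<in> D" "h \<in> D" "ev g x = ev h x"
    have "g - h = 0" by (rule zero_iff) (use h diffD in auto)
    thus "g = h" by simp
  qed
  hence cK: "card K = CARD('a) ^ n" by (simp add: K_def card_image cD)
  hence finK: "finite K" using finite_UNIV_card_ge_0[where ?'a='a]
    by (intro card_ge_0_finite) simp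
  have K0: "0 \<in> K" unfolding K_def by (rule image_eqI[of _ _ 0]) (auto simp: D_def)
  have closed: "x * y \<in> K" if yK: "y \<in> K" for y
  proof -
    obtain g where g: "g \<in> D" "y = ev g x" using yK by (auto simp: K_def)
    define h where "h = pCons 0 g mod f"
    have "ev h x = x * y" using assms(2) g by (simp add: h_def flip: minus_div_mult_eq_mod)
    moreover have "h \<in> D"
      using degree_mod_less[OF f0, of "pCons 0 g"]
      by (auto simp: D_def h_def n_def intro: coeff_eq_0)
    ultimately show ?thesis unfolding K_def by (metis image_eqI)
  qed
  have img: "(\<lambda>y. x * y) ` (K - {0}) = K - {0}"
    by (rule endo_inj_surj) (use finK closed False in \<open>auto simp: inj_on_def\<close>)
  have "(\<Prod>y\<in>K-{0}. y) = (\<Prod>y\<in>(\<lambda>y. x * y) ` (K - {0}). y)" by (simp only: img)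
  also have "\<dots> = (\<Prod>y\<in>K-{0}. x * y)"
    by (subst prod.reindex) (use False in \<open>auto simp: inj_on_def\<close>)
  also have "\<dots> = x ^ card (K - {0}) * (\<Prod>y\<in>K-{0}. y)" by (simp add: prod.distrib)
  finally have "x ^ card (K - {0}) = 1" using finK by (simp add: prod_zero_iff)
  moreover have "Suc (card (K - {0})) = CARD('a) ^ n"
    using K0 finK cK by (metis card_Suc_Diff1)
  ultimately have "x ^ (CARD('a) ^ n) = x" by (metis mult.right_neutral power_Suc)
  thus ?thesis by (simp add: n_def)
qed (simp add: power_0_left)

lemma power_CHAR_eq_self_iff:
  fixes x :: "'a::finite_field alg_closure"
  shows "x ^ CHAR('a) = x \<longleftrightarrow> x \<in> prime_subfield"
proof -
  define p where "p = CHAR('a)"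
  have p: "prime p" by (simp add: p_def)
  define g :: "'a alg_closure poly" where "g = monom 1 p - monom 1 1"
  have deg: "degree g = p"
    unfolding g_def using prime_gt_1_nat[OF p]
    by (subst diff_conv_add_uminus, subst degree_add_eq_left) (auto simp: degree_monom_eq)
  have g0: "g \<noteq> 0" using deg prime_gt_0_nat[OF p] by auto
  have roots: "{x. poly g x = 0} = {x. x ^ p = x}"
    by (simp add: g_def poly_monom)
  have fr: "of_nat k ^ p = (of_nat k :: 'a alg_closure)" for k
    using p by (induction k) (auto simp: freshmans_dream p_def power_0_left)
  have sub: "(prime_subfield :: 'a alg_closure set) \<subseteq> {x. x ^ p = x}"
    using fr by (auto simp: prime_subfield_def)
  have inj: "inj_on (of_nat :: nat \<Rightarrow> 'a alg_closure) {..<p}"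
    by (rule inj_onI) (auto simp: of_nat_eq_iff_cong_CHAR cong_def p_def)
  have fin: "finite {x :: 'a alg_closure. x ^ p = x}"
    using poly_roots_finite[OF g0] roots by simp
  have "p = card (of_nat ` {..<p} :: 'a alg_closure set)" using inj by (simp add: card_image)
  also have "\<dots> \<le> card (prime_subfield :: 'a alg_closure set)"
    by (intro card_mono finite_subset[OF sub fin]) (auto simp: prime_subfield_def)
  finally have "card {x :: 'a alg_closure. x ^ p = x} \<le> card (prime_subfield :: 'a alg_closure set)"
    using card_poly_roots_bound[OF g0] unfolding roots deg by linarith
  with sub fin have "prime_subfield = {x :: 'a alg_closure. x ^ p = x}"
    by (metis card_seteq)
  thus ?thesis by (auto simp: p_def)
qed

lemma abs_trace_in_prime_subfield:
  fixes x :: "'a::finite_field alg_closure"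
  assumes "x ^ (CHAR('a) ^ N) = x"
  shows "abs_trace N x \<in> prime_subfield"
proof -
  define p where "p = CHAR('a)"
  have "abs_trace N x ^ p = (\<Sum>i<N. (x ^ p ^ i) ^ p)"
    unfolding abs_trace_def p_def by (subst freshmans_dream_sum) auto
  also have "\<dots> = (\<Sum>i<N. x ^ p ^ Suc i)" by (simp add: mult.commute flip: power_mult)
  also have "\<dots> = (\<Sum>i<N. x ^ p ^ i) + x ^ p ^ N - x"
    using sum.lessThan_Suc[of "\<lambda>i. x ^ p ^ i" N] sum.lessThan_Suc_shift[of "\<lambda>i. x ^ p ^ i" N]
    by (simp add: algebra_simps del: sum.lessThan_Suc)
  also have "\<dots> = abs_trace N x" using assms by (simp add: abs_trace_def p_def)
  finally show ?thesis unfolding p_def power_CHAR_eq_self_iff .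
qed

lemma irreducible_has_root:
  fixes f :: "'a::field poly"
  assumes "irreducible f"
  shows "\<exists>x. ev f x = 0"
proof -
  have "degree f > 0"
    using assms is_unit_iff_degree[of f] by (auto simp: irreducible_def)
  hence "degree (map_poly to_ac f) > 0" by (simp add: degree_map_poly)
  thus ?thesis by (rule alg_closed_imp_poly_has_root)
qed

lemma poly_trace_eq:
  fixes f :: "'a::finite_field poly"
  assumes "irreducible f" "ev f x = 0"
  shows "poly_trace f = abs_trace (prime_degree TYPE('a) * degree f) x"
    and "poly_trace f \<in> prime_subfield"
proof -
  define N where "N = prime_degree TYPE('a) * degree f"
  define y where "y = (SOME y. ev f y = 0)"
  have y: "ev f y = 0" unfolding y_def by (rule someI[of _ x]) (rule assms)
  have "CHAR('a) ^ N = CARD('a) ^ degree f"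
    by (simp add: N_def power_mult CHAR_power_prime_degree)
  hence *: "abs_trace N y \<in> prime_subfield"
    using root_in_extension[OF assms(1) y] by (intro abs_trace_in_prime_subfield) simp
  then obtain k where k: "abs_trace N y = of_nat k" by (auto simp: prime_subfield_def)
  define T :: "'a poly" where "T = (\<Sum>i<N. monom 1 (CHAR('a) ^ i)) - [:of_nat k:]"
  have T: "ev T z = abs_trace N z - of_nat k" for z
    by (simp add: T_def ev_sum ev_monom abs_trace_def)
  have "f dvd T" using k by (intro irreducible_dvd_of_common_root[OF assms(1) y]) (simp add: T)
  then obtain g where "T = f * g" ..
  hence "ev T x = 0" using assms(2) by simp
  thus "poly_trace f = abs_trace N x" using k by (simp add: T poly_trace_def N_def y_def)
  show "poly_trace f \<in> prime_subfield" using * by (simp add: poly_trace_def N_def y_def)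
qed

text \<open>In particular, the cardinalities of the sets \<open>S a n\<close> are genuine.\<close>
lemma finite_S: "finite (S a n)"
proof (rule finite_subset)
  show "S a n \<subseteq> Poly ` {xs. set xs \<subseteq> UNIV \<and> length xs \<le> Suc n}"
  proof
    fix f assume "f \<in> S a n"
    hence "length (coeffs f) \<le> Suc n"
      by (auto simp: S_def monic_irreducibles_def coeffs_def)
    thus "f \<in> Poly ` {xs. set xs \<subseteq> UNIV \<and> length xs \<le> Suc n}"
      by (intro image_eqI[of _ _ "coeffs f"]) auto
  qed
qed (intro finite_imageI finite_lists_length_le finite)

end

theory Submission
  imports Defs
begin

text \<open>
  Write \<open>A n\<close> and \<open>B n\<close> for the numbers of monic irreducible polynomials of degree \<open>n\<close> with
  nonzero trace and with arbitrary trace; the left-hand side of the theorem is then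
  \<open>p A n - (p - 1) B n\<close>. Each element of the field with \<open>q ^ n\<close> elements is a root of exactly one
  monic irreducible \<open>f\<close>, whose degree \<open>d\<close> divides \<open>n\<close>, and its trace over that field is \<open>n / d\<close>
  times the trace of \<open>f\<close>. As every trace value is taken \<open>q ^ n / p\<close> times, counting elements gives
  \<open>\<Sum>\<^bsub>d | n\<^esub> d B d = q ^ n\<close> and, summing over those \<open>d\<close> with \<open>p\<close> not dividing \<open>n / d\<close>,
  \<open>\<Sum> d A d = (p - 1) q ^ n / p\<close>. The recursion follows from these by induction on \<open>n\<close>.
\<close>

section \<open>Finite subfields of the closure and roots of irreducible polynomials\<close>

text \<open>Split off one root: if f = (X - z) g, then f' = g + (X - z) g'. At \<open>z\<close> this
  shows that \<open>z\<close> is not a root of \<open>g\<close>; at a root of \<open>g\<close> it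
  shows that \<open>g\<close> inherits the hypothesis, so induction on the degree applies.\<close>

lemma card_roots_separable:
  fixes f :: "'b::alg_closed_field poly"
  assumes "f \<noteq> 0" "\<And>x. poly f x = 0 \<Longrightarrow> poly (pderiv f) x \<noteq> 0"
  shows "card {x. poly f x = 0} = degree f"
  using assms
proof (induction "degree f" arbitrary: f)
  case 0
  then obtain c where "f = [:c:]" using degree_eq_zeroE by metis
  with 0 show ?case by simp
next
  case (Suc k)
  then obtain z where z: "poly f z = 0"
    using alg_closed_imp_poly_has_root[of f] by auto
  then obtain g where g: "f = [:-z, 1:] * g"
    using poly_eq_0_iff_dvd by blast
  have g0: "g \<noteq> 0" using g Suc.prems(1) by auto
  have d: "poly (pderiv f) x = poly g x + (x - z) * poly (pderiv g) x" for x
    unfolding g by (subst pderiv_mult) (simp add: pderiv_pCons algebra_simps)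
  have gz: "poly g z \<noteq> 0" using Suc.prems(2)[OF z] by (simp add: d)
  have deg: "degree f = Suc (degree g)" unfolding g by (subst degree_mult_eq) (use g0 in auto)
  have "card {x. poly g x = 0} = degree g"
  proof (rule Suc.hyps(1))
    fix x assume x: "poly g x = 0"
    hence "poly f x = 0" by (simp add: g)
    from Suc.prems(2)[OF this] x show "poly (pderiv g) x \<noteq> 0" by (simp add: d)
  qed (use Suc.hyps(2) deg g0 in auto)
  moreover have "{x. poly f x = 0} = insert z {x. poly g x = 0}" by (auto simp: g)
  ultimately show ?case
    using gz deg poly_roots_finite[OF g0] by simp
qed

text \<open>For \<open>n > 0\<close> this is the subfield of order \<open>CARD('a) ^ n\<close>. For
  \<open>n = 0\<close> the condition is trivial and the set is the whole closure, whence the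
  positivity assumptions below.\<close>

definition ext_field :: "nat \<Rightarrow> 'a::finite_field alg_closure set" where
  "ext_field n = {x. x ^ (CARD('a) ^ n) = x}"

lemma card_eq_CHAR_power:
  "CARD('a::finite_field) ^ n = CHAR('a) ^ (prime_degree TYPE('a) * n)"
  by (simp add: power_mult CHAR_power_prime_degree)

lemma card_field_gt_1: "CARD('a::finite_field) > 1"
  using card_mono[of UNIV "{0 :: 'a, 1}"] by simp

lemma prime_degree_pos: "prime_degree TYPE('a::finite_field) > 0"
  using CHAR_power_prime_degree[where ?'a='a] card_field_gt_1[where ?'a='a]
  by (cases "prime_degree TYPE('a) = 0") auto

text \<open>The power map is a ring endomorphism of the closure and fixes the coefficients of
  \<open>f\<close>, which come from the finite base field.\<close>

lemma ev_power_card_power: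
  fixes f :: "'a::finite_field poly"
  shows "ev f x ^ (CARD('a) ^ k) = ev f (x ^ (CARD('a) ^ k))"
proof (induction f)
  case (pCons a f)
  have "(to_ac a + x * ev f x) ^ (CARD('a) ^ k) =
          to_ac a ^ (CARD('a) ^ k) + (x * ev f x) ^ (CARD('a) ^ k)"
    by (rule freshmans_dream'[where n = "prime_degree TYPE('a) * k"])
       (simp_all add: card_eq_CHAR_power)
  also have "to_ac a ^ (CARD('a) ^ k) = to_ac a"
    by (metis finite_field_power_card_power_eq_same to_ac_power)
  finally show ?case using pCons.IH by (simp add: power_mult_distrib)
qed (simp add: power_0_left)

text \<open>With \<open>k = CARD('a) ^ n\<close> its roots in the closure are exactly
  \<open>ext_field n\<close>.\<close>

abbreviation frob_poly :: "nat \<Rightarrow> 'b::field poly" where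
  "frob_poly k \<equiv> monom 1 k - monom 1 1"

lemma frob_poly_nonzero: "k > 1 \<Longrightarrow> (frob_poly k :: 'b::field poly) \<noteq> 0"
  by (simp add: monom_eq_iff')

lemma card_ext_field_le:
  assumes "n > 0"
  shows "finite (ext_field n :: 'a::finite_field alg_closure set)"
    and "card (ext_field n :: 'a alg_closure set) \<le> CARD('a) ^ n"
proof -
  let ?g = "frob_poly (CARD('a) ^ n) :: 'a alg_closure poly"
  have g0: "?g \<noteq> 0"
    using card_field_gt_1[where ?'a='a] assms by (intro frob_poly_nonzero one_less_power)
  have eq: "ext_field n = {x. poly ?g x = 0}"
    by (simp add: ext_field_def poly_monom)
  show "finite (ext_field n :: 'a alg_closure set)"
    unfolding eq by (rule poly_roots_finite[OF g0])
  have "degree ?g \<le> CARD('a) ^ n"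
    by (intro degree_diff_le degree_monom_le order_trans[OF degree_monom_le])
       (simp add: Suc_leI)
  thus "card (ext_field n :: 'a alg_closure set) \<le> CARD('a) ^ n"
    unfolding eq using card_poly_roots_bound[OF g0] by linarith
qed

text \<open>The field generated by \<open>x\<close> has \<open>q ^ degree f\<close> elements and lies in \<open>ext_field k\<close>.\<close>
lemma degree_le_of_root_in_ext_field:
  fixes f :: "'a::finite_field poly"
  assumes "irreducible f" "ev f x = 0" "x \<in> ext_field k" "k > 0"
  shows "degree f \<le> k"
proof -
  \<comment> \<open>These lists encode the polynomials of degree below \<open>degree f\<close>. Two
    of them with the same value at \<open>x\<close> differ by a multiple of \<open>f\<close>, so
    they coincide.\<close>
  define L where "L = {xs :: 'a list. length xs = degree f}"
  have "inj_on (\<lambda>xs. ev (Poly xs) x) L"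
  proof (rule inj_onI)
    fix xs ys assume L: "xs \<in> L" "ys \<in> L" and eq: "ev (Poly xs) x = ev (Poly ys) x"
    have dvd: "f dvd Poly xs - Poly ys"
      using eq by (intro irreducible_dvd_of_common_root[OF assms(1,2)]) simp
    have c: "coeff (Poly xs - Poly ys) i = 0" if "i \<ge> degree f" for i
      using L that by (simp add: L_def nth_default_def)
    have "Poly xs - Poly ys = 0"
    proof (rule ccontr)
      assume n0: "Poly xs - Poly ys \<noteq> 0"
      hence "degree f \<le> degree (Poly xs - Poly ys)" using dvd by (rule dvd_imp_degree_le[rotated])
      from c[OF this] n0 show False using leading_coeff_neq_0 by blast
    qed
    hence "Poly xs = Poly ys" by simp
    hence "nth_default 0 xs i = nth_default 0 ys i" for i by (metis coeff_Poly_eq)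
    thus "xs = ys" using L by (metis (mono_tags) L_def mem_Collect_eq nth_default_nth nth_equalityI)
  qed
  moreover have "(\<lambda>xs. ev (Poly xs) x) ` L \<subseteq> ext_field k"
    using assms(3) by (auto simp: ext_field_def ev_power_card_power)
  ultimately have "card L \<le> card (ext_field k :: 'a alg_closure set)"
    using card_ext_field_le(1)[OF assms(4)] by (rule card_inj_on_le)
  also have "\<dots> \<le> CARD('a) ^ k" by (rule card_ext_field_le(2)[OF assms(4)])
  finally have "CARD('a) ^ degree f \<le> CARD('a) ^ k"
    using card_lists_length_eq[of "UNIV :: 'a set" "degree f"] by (simp add: L_def)
  thus ?thesis using card_field_gt_1[where ?'a='a] by simp
qed

lemma ext_field_mult:
  assumes "x \<in> ext_field d"
  shows "x \<in> ext_field (d * k)"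
  using assms
  by (induction k) (auto simp: ext_field_def power_add power_mult)

lemma ext_field_mono: "d dvd n \<Longrightarrow> ext_field d \<subseteq> ext_field n"
  using ext_field_mult by (auto elim!: dvdE)

text \<open>Euclidean division of Frobenius exponents: \<open>x\<close> is fixed by the powers
  belonging to \<open>degree f\<close> and to \<open>n\<close>, hence by the one belonging to
  \<open>n mod degree f\<close>. A positive remainder would be a field degree too small to contain
  \<open>x\<close>.\<close>

lemma degree_dvd_of_root_in_ext_field:
  fixes f :: "'a::finite_field poly"
  assumes "irreducible f" "ev f x = 0" "x \<in> ext_field n"
  shows "degree f dvd n"
proof (rule ccontr)
  assume ndvd: "\<not> degree f dvd n"
  define d where "d = degree f"
  have d0: "d > 0"
    using assms(1) is_unit_iff_degree[of f] by (auto simp: irreducible_def d_def)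
  have "x \<in> ext_field d"
    using root_in_extension[OF assms(1,2)] by (simp add: ext_field_def d_def)
  hence "x ^ (CARD('a) ^ (d * (n div d))) = x"
    using ext_field_mult[of x d "n div d"] by (simp add: ext_field_def)
  moreover have "(x ^ (CARD('a) ^ (d * (n div d)))) ^ (CARD('a) ^ (n mod d)) = x"
    using assms(3) by (simp only: flip: power_mult power_add) (simp add: ext_field_def)
  ultimately have "x \<in> ext_field (n mod d)" by (simp add: ext_field_def)
  moreover have "n mod d > 0" using ndvd by (simp add: d_def mod_greater_zero_iff_not_dvd)
  ultimately have "d \<le> n mod d"
    using degree_le_of_root_in_ext_field[OF assms(1,2)] by (simp add: d_def)
  thus False using mod_less_divisor[OF d0, of n] by simp
qed

text \<open>With q = \<open>CARD('a)\<close> and d = \<open>degree f\<close>, f divides X^(q^d) - X,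
  whose derivative is -1. The product rule then excludes a common root of \<open>f\<close> and
  \<open>pderiv f\<close>.\<close>

lemma card_roots_irreducible:
  fixes f :: "'a::finite_field poly"
  assumes "irreducible f"
  shows "finite {x. ev f x = 0}" and "card {x. ev f x = 0} = degree f"
proof -
  let ?q = "CARD('a)" and ?F = "map_poly to_ac f"
  have f0: "?F \<noteq> 0" using assms by (subst map_poly_eq_0_iff) auto
  thus "finite {x. ev f x = 0}" by (rule poly_roots_finite)
  obtain y where y: "ev f y = 0" using irreducible_has_root[OF assms] by blast
  have "f dvd frob_poly (?q ^ degree f)"
    using root_in_extension[OF assms y]
    by (intro irreducible_dvd_of_common_root[OF assms y]) (simp only: ev_diff ev_monom, simp)
  then obtain g where g: "frob_poly (?q ^ degree f) = f * g" ..
  have "degree f > 0"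
    using assms is_unit_iff_degree[of f] by (auto simp: irreducible_def)
  hence "of_nat (?q ^ degree f) = (0 :: 'a)"
    using prime_degree_pos[where ?'a='a] by (simp add: card_eq_CHAR_power power_0_left)
  hence "pderiv (frob_poly (?q ^ degree f)) = (- 1 :: 'a poly)"
    by (simp only: pderiv_diff pderiv_monom) simp
  hence d: "f * pderiv g + g * pderiv f = - 1"
    unfolding g pderiv_mult .
  have pd: "pderiv ?F = map_poly to_ac (pderiv f)"
    by (intro poly_eqI) (simp add: coeff_pderiv coeff_map_poly)
  have "card {x. ev f x = 0} = degree ?F"
  proof (rule card_roots_separable[OF f0])
    fix x assume x: "ev f x = 0"
    have "ev (f * pderiv g + g * pderiv f) x = - 1" unfolding d by simp
    hence "ev g x * ev (pderiv f) x = - 1" using x by simp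
    thus "poly (pderiv ?F) x \<noteq> 0" unfolding pd by auto
  qed
  thus "card {x. ev f x = 0} = degree f" by (simp add: degree_map_poly)
qed

section \<open>Minimal polynomials and the partition of \<open>ext_field n\<close>\<close>

text \<open>The witness is the minimal polynomial of \<open>x\<close>: a nonzero polynomial of least
  degree vanishing at \<open>x\<close>, made monic.\<close>

lemma ex_monic_irreducible_root:
  fixes g :: "'a::field poly"
  assumes "g \<noteq> 0" "ev g x = 0"
  shows "\<exists>f. lead_coeff f = 1 \<and> irreducible f \<and> ev f x = 0"
proof -
  define P where "P = (\<lambda>h :: 'a poly. h \<noteq> 0 \<and> ev h x = 0)"
  have "P g" using assms by (simp add: P_def)
  then obtain h where h: "P h" and min: "\<And>k. P k \<Longrightarrow> degree h \<le> degree k"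
    using ex_has_least_nat[of P g degree] by blast
  define f where "f = smult (inverse (lead_coeff h)) h"
  have f: "P f" "lead_coeff f = 1" "degree f = degree h" using h by (auto simp: P_def f_def)
  \<comment> \<open>By minimality the factor vanishing at \<open>x\<close> already has the full
    degree, so the cofactor is constant.\<close>
  have unit: "b dvd 1" if "f = a * b" "ev a x = 0" for a b
  proof -
    have nz: "a \<noteq> 0" "b \<noteq> 0" using f(1) that(1) by (auto simp: P_def)
    have "degree h \<le> degree a" using that(2) nz by (intro min) (simp add: P_def)
    moreover have "degree h = degree a + degree b"
      using nz by (simp flip: f(3) add: that(1) degree_mult_eq)
    ultimately show ?thesis using nz is_unit_iff_degree[of b] by simp
  qed
  have "irreducible f"
  proof (rule irreducibleI)
    show "f \<noteq> 0" using f(1) by (simp add: P_def)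
    show "\<not> f dvd 1"
    proof
      assume "f dvd 1"
      then obtain u where "1 = f * u" ..
      hence "ev f x * ev u x = 1" by (simp flip: ev_mult)
      thus False using f(1) by (simp add: P_def)
    qed
  next
    fix a b assume ab: "f = a * b"
    hence "ev a x = 0 \<or> ev b x = 0" using f(1) by (auto simp: P_def)
    thus "a dvd 1 \<or> b dvd 1" using unit[of a b] unit[of b a] ab by (auto simp: mult.commute)
  qed
  thus ?thesis using f(1,2) unfolding P_def by blast
qed

lemma image_to_ac_prime_subfield:
  "to_ac ` prime_subfield = (prime_subfield :: 'a::field alg_closure set)"
  by (force simp: prime_subfield_def)

lemma monic_irreducibles_eq_UN_S:
  "monic_irreducibles n = (\<Union>a\<in>prime_subfield. S (a :: 'a::finite_field) n)"
proof -
  have "\<exists>a\<in>prime_subfield. poly_trace f = to_ac a" if "f \<in> monic_irreducibles n" for f :: "'a poly"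
  proof -
    have irr: "irreducible f" using that by (simp add: monic_irreducibles_def)
    obtain y where "ev f y = 0" using irreducible_has_root[OF irr] by blast
    from poly_trace_eq(2)[OF irr this] show ?thesis
      by (auto simp flip: image_to_ac_prime_subfield)
  qed
  thus ?thesis by (auto simp: S_def)
qed

lemma finite_monic_irreducibles: "finite (monic_irreducibles n :: 'a::finite_field poly set)"
  by (simp add: monic_irreducibles_eq_UN_S finite_S)

lemma monic_irreducible_eqI:
  fixes f g :: "'a::field poly"
  assumes "lead_coeff f = 1" "irreducible f" "lead_coeff g = 1" "irreducible g"
    and "ev f x = 0" "ev g x = 0"
  shows "f = g"
proof -
  have fg: "f dvd g" and gf: "g dvd f" using assms irreducible_dvd_of_common_root by blast+
  from fg obtain h where h: "g = f * h" ..
  have "f \<noteq> 0" "g \<noteq> 0" using assms by auto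
  hence "degree g = degree f"
    using fg gf by (simp add: dvd_imp_degree_le le_antisym)
  hence "degree h = 0" using h \<open>f \<noteq> 0\<close> \<open>g \<noteq> 0\<close> by (auto simp: degree_mult_eq)
  then obtain c where c: "h = [:c:]" using degree_eq_zeroE by metis
  have "lead_coeff g = lead_coeff f * lead_coeff h" unfolding h by (rule lead_coeff_mult)
  hence "c = 1" using assms c by simp
  thus ?thesis using h c by simp
qed

text \<open>The root sets of the monic irreducible \<open>f\<close> with degree \<open>d\<close>
  dividing \<open>n\<close> partition \<open>ext_field n\<close>, and each has \<open>d\<close>
  elements. \<open>H f\<close> is the common value of \<open>h\<close> on the conjugates.\<close>

lemma sum_ext_field:
  fixes H :: "'a::finite_field poly \<Rightarrow> int"
  assumes n: "n > 0"
    and H: "\<And>d f x. d dvd n \<Longrightarrow> f \<in> monic_irreducibles d \<Longrightarrow> ev f x = 0 \<Longrightarrow> h x = H f"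
  shows "(\<Sum>x\<in>ext_field n. h x) = (\<Sum>d | d dvd n. int d * (\<Sum>f\<in>monic_irreducibles d. H f))"
proof -
  define I where "I = (\<Union>d\<in>{d. d dvd n}. monic_irreducibles d :: 'a poly set)"
  have irr: "irreducible f" if "f \<in> I" for f
    using that by (auto simp: I_def monic_irreducibles_def)
  have fin: "finite {d. d dvd n}" using n by simp
  have "ext_field n = (\<Union>f\<in>I. {x. ev f x = 0})"
  proof (intro equalityI subsetI)
    fix x :: "'a alg_closure" assume x: "x \<in> ext_field n"
    have "\<exists>f. lead_coeff f = 1 \<and> irreducible f \<and> ev f x = 0"
    proof (rule ex_monic_irreducible_root)
      show "(frob_poly (CARD('a) ^ n) :: 'a poly) \<noteq> 0"
        using card_field_gt_1[where ?'a='a] n by (intro frob_poly_nonzero one_less_power)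
      show "ev (frob_poly (CARD('a) ^ n)) x = 0"
        using x by (simp only: ev_diff ev_monom) (simp add: ext_field_def)
    qed
    then obtain f where "lead_coeff f = 1" "irreducible f" "ev f x = 0" by blast
    with degree_dvd_of_root_in_ext_field[OF this(2,3) x]
    show "x \<in> (\<Union>f\<in>I. {x. ev f x = 0})" by (auto simp: I_def monic_irreducibles_def)
  next
    fix x assume "x \<in> (\<Union>f\<in>I. {x. ev f x = 0})"
    then obtain f where f: "irreducible f" "degree f dvd n" "ev f x = 0"
      by (auto simp: I_def monic_irreducibles_def)
    thus "x \<in> ext_field n"
      using root_in_extension[OF f(1,3)] ext_field_mono[OF f(2)] by (auto simp: ext_field_def)
  qed
  moreover have "f = g" if "f \<in> I" "g \<in> I" "ev f x = 0" "ev g x = 0" for f g x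
    using that monic_irreducible_eqI[of f g x] by (auto simp: I_def monic_irreducibles_def)
  moreover have "finite I" using fin by (auto simp: I_def finite_monic_irreducibles)
  ultimately have "(\<Sum>x\<in>ext_field n. h x) = (\<Sum>f\<in>I. \<Sum>x | ev f x = 0. h x)"
    using irr by (simp only:, intro sum.UNION_disjoint) (auto simp: card_roots_irreducible)
  also have "\<dots> = (\<Sum>d | d dvd n. \<Sum>f\<in>monic_irreducibles d. \<Sum>x | ev f x = 0. h x)"
    unfolding I_def using n
    by (intro sum.UNION_disjoint) (auto simp: finite_monic_irreducibles, auto simp: monic_irreducibles_def)
  also have "\<dots> = (\<Sum>d | d dvd n. \<Sum>f\<in>monic_irreducibles d. int d * H f)"
  proof (intro sum.cong refl)
    fix d f assume d: "d \<in> {d. d dvd n}" and f: "f \<in> (monic_irreducibles d :: 'a poly set)"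
    have "(\<Sum>x | ev f x = 0. h x) = (\<Sum>x | ev f x = 0. H f)"
      using d f H by (intro sum.cong) auto
    also have "\<dots> = int d * H f"
      using f by (simp add: monic_irreducibles_def card_roots_irreducible)
    finally show "(\<Sum>x | ev f x = 0. h x) = int d * H f" .
  qed
  finally show ?thesis by (simp add: sum_distrib_left)
qed


section \<open>Distribution of the trace\<close>

text \<open>Frobenius sends each conjugate to the next, so the sum gains a term at the end and loses
  \<open>x\<close>. Hence the trace is fixed by Frobenius exactly when
  \<open>x ^ (CHAR('b) ^ N) = x\<close>.\<close>

lemma abs_trace_power_CHAR:
  fixes x :: "'b::field"
  assumes "prime CHAR('b)"
  shows "abs_trace N x ^ CHAR('b) = abs_trace N x + x ^ (CHAR('b) ^ N) - x"
proof -
  have "abs_trace N x ^ CHAR('b) = (\<Sum>i<N. x ^ CHAR('b) ^ Suc i)"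
    unfolding abs_trace_def
    by (subst freshmans_dream_sum) (auto simp: assms mult.commute simp flip: power_mult)
  thus ?thesis
    using sum.lessThan_Suc[of "\<lambda>i. x ^ CHAR('b) ^ i" N]
      sum.lessThan_Suc_shift[of "\<lambda>i. x ^ CHAR('b) ^ i" N]
    by (simp add: abs_trace_def algebra_simps del: sum.lessThan_Suc)
qed

text \<open>The conjugates repeat with period \<open>N\<close>, so the long sum falls into
  \<open>k\<close> equal blocks.\<close>

lemma abs_trace_mult:
  fixes x :: "'b::field"
  assumes "x ^ (CHAR('b) ^ N) = x"
  shows "abs_trace (k * N) x = of_nat k * abs_trace N x"
proof -
  have pow: "x ^ (CHAR('b) ^ (j * N + i)) = x ^ (CHAR('b) ^ i)" for i j
    by (induction j) (use assms in \<open>simp_all add: power_add power_mult\<close>)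
  have "abs_trace (k * N) x = (\<Sum>j<k. \<Sum>i\<in>{j * N..<j * N + N}. x ^ (CHAR('b) ^ i))"
    by (simp add: abs_trace_def sum.nat_group)
  also have "\<dots> = (\<Sum>j<k. abs_trace N x)"
  proof (rule sum.cong[OF refl])
    fix j
    show "(\<Sum>i\<in>{j * N..<j * N + N}. x ^ (CHAR('b) ^ i)) = abs_trace N x"
      unfolding abs_trace_def
      by (rule sum.reindex_bij_witness[of _ "\<lambda>i. j * N + i" "\<lambda>i. i - j * N"])
         (auto simp: pow simp flip: pow[of j "_ - j * N"])
  qed
  finally show ?thesis by simp
qed

text \<open>The polynomial \<open>\<Sum>\<^sub>i\<^sub><\<^sub>N X^(p^i) - c\<close> has derivative \<open>1\<close>, hence only simple roots.\<close>
lemma card_abs_trace_fibre: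
  fixes c :: "'a::finite_field alg_closure"
  assumes "N > 0"
  shows "card {x. abs_trace N x = c} = CHAR('a) ^ (N - 1)"
proof -
  define p where "p = CHAR('a)"
  have p: "p > 1" using prime_gt_1_nat[of p] by (simp add: p_def)
  define T where "T = (\<lambda>N. \<Sum>i<N. monom (1 :: 'a alg_closure) (p ^ i))"
  have deg: "degree (T (Suc M)) = p ^ M" for M
  proof (induction M)
    case (Suc M)
    have "degree (T (Suc M) + monom 1 (p ^ Suc M)) = degree (monom (1 :: 'a alg_closure) (p ^ Suc M))"
      by (rule degree_add_eq_right) (use p Suc in \<open>simp add: degree_monom_eq\<close>)
    thus ?case by (simp add: T_def degree_monom_eq)
  qed (simp add: T_def degree_monom_eq)
  have "of_nat p = (0 :: 'a alg_closure)"
    using of_nat_CHAR[where ?'a = "'a alg_closure"] by (simp add: p_def)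
  hence pd: "pderiv (T (Suc M)) = 1" for M
    by (induction M) (simp_all add: T_def pderiv_add pderiv_monom)
  obtain M where M: "N = Suc M" using assms gr0_conv_Suc by auto
  have degf: "degree (T N - [:c:]) = p ^ M"
    unfolding diff_conv_add_uminus using deg[of M] p
    by (subst degree_add_eq_left) (simp_all add: M)
  have "card {x. poly (T N - [:c:]) x = 0} = degree (T N - [:c:])"
  proof (rule card_roots_separable)
    show "T N - [:c:] \<noteq> 0" using degf p by auto
  qed (simp add: M pderiv_diff pd)
  moreover have "poly (T N - [:c:]) x = abs_trace N x - c" for x
    by (simp add: T_def poly_sum poly_monom abs_trace_def p_def)
  ultimately show ?thesis using degf by (simp add: M p_def)
qed

lemma card_prime_subfield:
  assumes "CHAR('b::ring_1) > 0"
  shows "card (prime_subfield :: 'b set) = CHAR('b)"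
proof -
  have "prime_subfield = (of_nat :: nat \<Rightarrow> 'b) ` {..<CHAR('b)}"
  proof -
    have "of_nat k = (of_nat (k mod CHAR('b)) :: 'b)" for k
      by (subst of_nat_eq_iff_cong_CHAR) (simp add: cong_def)
    moreover have "k mod CHAR('b) < CHAR('b)" for k using assms by simp
    ultimately show ?thesis unfolding prime_subfield_def by blast
  qed
  moreover have "inj_on (of_nat :: nat \<Rightarrow> 'b) {..<CHAR('b)}"
    by (rule inj_onI) (auto simp: of_nat_eq_iff_cong_CHAR cong_def)
  ultimately show ?thesis by (metis card_image card_lessThan)
qed

text \<open>All fibres over the prime field have \<open>CHAR('a) ^ (N - 1)\<close> elements; the
  factor \<open>CHAR('a)\<close> on the left avoids a division.\<close>

lemma sum_trace_ext_field:
  fixes W :: "'a::finite_field alg_closure \<Rightarrow> int"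
  assumes "n > 0"
  defines "N \<equiv> prime_degree TYPE('a) * n"
  shows "int CHAR('a) * (\<Sum>x\<in>ext_field n. W (abs_trace N x))
           = int CARD('a) ^ n * (\<Sum>c\<in>prime_subfield. W c)"
proof -
  have N: "N > 0" using assms prime_degree_pos by (simp add: N_def)
  have mem: "x \<in> ext_field n \<longleftrightarrow> x ^ (CHAR('a) ^ N) = x" for x :: "'a alg_closure"
    by (simp add: ext_field_def card_eq_CHAR_power N_def)
  \<comment> \<open>Counting in the whole closure adds nothing: \<open>c ^ CHAR('a) = c\<close>
    forces \<open>x\<close> into \<open>ext_field n\<close> by
    \<open>abs_trace_power_CHAR\<close>.\<close>
  have fibre: "{x \<in> ext_field n. abs_trace N x = c} = {x. abs_trace N x = c}"
    if "c \<in> prime_subfield" for c :: "'a alg_closure"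
    using that abs_trace_power_CHAR[where ?'b = "'a alg_closure" and N = N]
    by (auto simp: mem simp flip: power_CHAR_eq_self_iff)
  have "finite (prime_subfield :: 'a alg_closure set)"
    by (simp flip: image_to_ac_prime_subfield)
  hence "(\<Sum>x\<in>ext_field n. W (abs_trace N x))
      = (\<Sum>c\<in>prime_subfield. \<Sum>x | x \<in> ext_field n \<and> abs_trace N x = c. W (abs_trace N x))"
    using card_ext_field_le(1)[OF assms(1)] abs_trace_in_prime_subfield[of _ N]
    by (intro sum.group[symmetric]) (auto simp: mem)
  also have "\<dots> = (\<Sum>c\<in>prime_subfield. int (CHAR('a) ^ (N - 1)) * W c)"
    using N by (intro sum.cong refl) (simp add: fibre card_abs_trace_fibre)
  finally have "int CHAR('a) * (\<Sum>x\<in>ext_field n. W (abs_trace N x))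
      = int (CHAR('a) * CHAR('a) ^ (N - 1)) * (\<Sum>c\<in>prime_subfield. W c)"
    by (simp add: mult.assoc flip: sum_distrib_left)
  also have "CHAR('a) * CHAR('a) ^ (N - 1) = CARD('a) ^ n"
    using N by (simp add: card_eq_CHAR_power N_def flip: power_Suc)
  finally show ?thesis by simp
qed

section \<open>Counting polynomials by trace and inverting the divisor sums\<close>

text \<open>One sum over \<open>ext_field n\<close> is evaluated twice, by minimal polynomials and
  by trace values. The weight \<open>W\<close> stays free: a constant counts all polynomials, an
  indicator those with nonzero trace.\<close>

lemma sum_poly_trace:
  fixes W :: "'a::finite_field alg_closure \<Rightarrow> int"
  assumes "n > 0"
  shows "int CHAR('a) * (\<Sum>d | d dvd n. int d *
             (\<Sum>f\<in>monic_irreducibles d. W (of_nat (n div d) * poly_trace f)))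
           = int CARD('a) ^ n * (\<Sum>c\<in>prime_subfield. W c)"
proof -
  let ?m = "prime_degree TYPE('a)"
  have "(\<Sum>x\<in>ext_field n. W (abs_trace (?m * n) x)) = (\<Sum>d | d dvd n. int d *
          (\<Sum>f\<in>monic_irreducibles d. W (of_nat (n div d) * poly_trace f)))"
  proof -
    \<comment> \<open>\<open>sum_ext_field\<close> asks for a value depending on \<open>f\<close>
      alone, hence \<open>degree f\<close> in place of \<open>d\<close>.\<close>
    have "W (abs_trace (?m * n) x) = W (of_nat (n div degree f) * poly_trace f)"
      if "d dvd n" and f: "f \<in> monic_irreducibles d" and x: "ev f x = 0" for d f x
    proof -
      have irr: "irreducible f" and d: "degree f = d"
        using f by (auto simp: monic_irreducibles_def)
      have "x ^ (CHAR('a) ^ (?m * d)) = x"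
        using root_in_extension[OF irr x] by (simp add: d card_eq_CHAR_power)
      hence "abs_trace (n div d * (?m * d)) x = of_nat (n div d) * abs_trace (?m * d) x"
        by (intro abs_trace_mult) simp
      moreover have "n div d * (?m * d) = ?m * n" using \<open>d dvd n\<close> by auto
      ultimately show ?thesis using poly_trace_eq(1)[OF irr x] by (simp add: d)
    qed
    from sum_ext_field[OF assms this]
    have "(\<Sum>x\<in>ext_field n. W (abs_trace (?m * n) x)) = (\<Sum>d | d dvd n. int d *
          (\<Sum>f\<in>monic_irreducibles d. W (of_nat (n div degree f) * poly_trace f)))" .
    thus ?thesis by (simp add: monic_irreducibles_def)
  qed
  thus ?thesis using sum_trace_ext_field[OF assms, of W] by simp
qed

text \<open>Both sides have the same sum over the divisors \<open>d\<close> of \<open>n\<close> with \<open>p\<close> not dividing \<open>n / d\<close>,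
  weighted by \<open>d\<close>, and such sums for all \<open>n\<close> determine a function.\<close>
lemma divisor_sum_recursion:
  fixes A B :: "nat \<Rightarrow> int" and p q n :: nat
  assumes p: "prime p"
    and sumA: "\<And>n. n > 0 \<Longrightarrow> int p * (\<Sum>d | d dvd n \<and> \<not> p dvd n div d. int d * A d)
                               = (int p - 1) * int q ^ n"
    and sumB: "\<And>n. n > 0 \<Longrightarrow> (\<Sum>d | d dvd n. int d * B d) = int q ^ n"
    and "n > 0"
  shows "int p * A n - (int p - 1) * B n = (if p dvd n then A (n div p) else 0)"
proof -
  \<comment> \<open>\<open>R\<close> is the claimed right-hand side and \<open>G\<close> the defect,
    to be shown zero.\<close>
  define R where "R = (\<lambda>n. if p dvd n then A (n div p) else 0)"
  define G where "G = (\<lambda>n. int p * A n - (int p - 1) * B n - R n)"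
  define Dv where "Dv = (\<lambda>n. {d. d dvd n \<and> \<not> p dvd n div d})"
  have p0: "p > 0" using p by (simp add: prime_gt_0_nat)
  have sumG: "(\<Sum>d\<in>Dv n. int d * G d) = 0" if n: "n > 0" for n
  proof -
    have fin: "finite {d. d dvd n}" using n by simp
    have split: "(\<Sum>d\<in>Dv n. int d * B d) = int q ^ n - (\<Sum>d | d dvd n \<and> p dvd n div d. int d * B d)"
    proof -
      have "{d. d dvd n} - {d. d dvd n \<and> p dvd n div d} = Dv n" by (auto simp: Dv_def)
      moreover have "{d. d dvd n \<and> p dvd n div d} \<subseteq> {d. d dvd n}" by blast
      ultimately have "(\<Sum>d | d dvd n. int d * B d) = (\<Sum>d\<in>Dv n. int d * B d)
          + (\<Sum>d | d dvd n \<and> p dvd n div d. int d * B d)"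
        using sum.subset_diff[OF _ fin] by metis
      thus ?thesis unfolding sumB[OF n] by linarith
    qed
    \<comment> \<open>If \<open>p\<close> does not divide \<open>n\<close>, both sides vanish. If
      \<open>n = p * k\<close>, both equal \<open>(int p - 1) * int q ^ k\<close>, the left by
      \<open>sumA\<close> and the right by \<open>sumB\<close>, each at \<open>k\<close>.\<close>
    have RB: "(\<Sum>d\<in>Dv n. int d * R d) = (int p - 1) * (\<Sum>d | d dvd n \<and> p dvd n div d. int d * B d)"
    proof (cases "p dvd n")
      case False
      hence "{d. d dvd n \<and> p dvd n div d} = {}"
        by (metis (mono_tags, lifting) Collect_empty_eq dvd_div_mult_self dvd_mult2)
      moreover have "R d = 0" if "d \<in> Dv n" for d
        using that False by (auto simp: Dv_def R_def dest: dvd_trans)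
      ultimately show ?thesis by (simp only: sum.empty) simp
    next
      case True
      then obtain k where k: "n = p * k" ..
      have k0: "k > 0" using n k by simp
      have "{d. d dvd n \<and> p dvd n div d} = {d. d dvd k}"
      proof (intro equalityI subsetI)
        fix d assume "d \<in> {d. d dvd n \<and> p dvd n div d}"
        hence "d * p dvd n"
          using n by (auto simp: dvd_div_iff_mult mult.commute)
        thus "d \<in> {d. d dvd k}" using p0 by (simp add: k mult.commute)
      next
        fix d assume "d \<in> {d. d dvd k}"
        thus "d \<in> {d. d dvd n \<and> p dvd n div d}" by (auto simp: k simp flip: div_mult_swap)
      qed
      moreover have "(\<Sum>d\<in>Dv n. int d * R d) = (\<Sum>e\<in>Dv k. int (p * e) * A e)"
      proof -
        \<comment> \<open>\<open>R\<close> vanishes off the multiples of \<open>p\<close>, and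
          \<open>p * e\<close> is in \<open>Dv (p * k)\<close> iff \<open>e\<close> is in
          \<open>Dv k\<close>, the quotient being the same.\<close>
        have "(\<Sum>d\<in>Dv n. int d * R d) = (\<Sum>d\<in>(\<lambda>e. p * e) ` Dv k. int d * R d)"
        proof (rule sum.mono_neutral_right)
          show "finite (Dv n)" using fin by (simp add: Dv_def)
          show "(\<lambda>e. p * e) ` Dv k \<subseteq> Dv n" using p0 by (auto simp: Dv_def k)
          show "\<forall>d\<in>Dv n - (\<lambda>e. p * e) ` Dv k. int d * R d = 0"
          proof
            fix d assume d: "d \<in> Dv n - (\<lambda>e. p * e) ` Dv k"
            have "\<not> p dvd d"
            proof
              assume "p dvd d"
              then obtain e where "d = p * e" ..
              with d p0 show False by (auto simp: Dv_def k)
            qed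
            thus "int d * R d = 0" by (simp add: R_def)
          qed
        qed
        also have "\<dots> = (\<Sum>e\<in>Dv k. int (p * e) * R (p * e))"
          using p0 by (subst sum.reindex) (auto simp: inj_on_def)
        also have "\<dots> = (\<Sum>e\<in>Dv k. int (p * e) * A e)"
          using p0 by (simp add: R_def)
        finally show ?thesis .
      qed
      moreover have "(\<Sum>e\<in>Dv k. int (p * e) * A e) = (int p - 1) * int q ^ k"
        using sumA[OF k0] by (simp add: Dv_def sum_distrib_left mult.assoc)
      ultimately show ?thesis using sumB[OF k0] by simp
    qed
    have "(\<Sum>d\<in>Dv n. int d * G d) = int p * (\<Sum>d\<in>Dv n. int d * A d)
            - (int p - 1) * (\<Sum>d\<in>Dv n. int d * B d) - (\<Sum>d\<in>Dv n. int d * R d)"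
      by (simp add: G_def algebra_simps sum.distrib sum_subtractf sum_distrib_left)
    moreover have "int p * (\<Sum>d\<in>Dv n. int d * A d) = (int p - 1) * int q ^ n"
      using sumA[OF n] by (simp add: Dv_def)
    ultimately show ?thesis unfolding RB split by (simp add: right_diff_distrib)
  qed
  \<comment> \<open>As \<open>n div n = 1\<close>, \<open>n\<close> itself lies in
    \<open>Dv n\<close>; the other members are smaller, so by induction \<open>sumG\<close> reduces
    to \<open>int n * G n = 0\<close>.\<close>
  have "G n = 0" using \<open>n > 0\<close>
  proof (induction n rule: less_induct)
    case (less n)
    have "G d = 0" if "d \<in> Dv n - {n}" for d
    proof (rule less.IH)
      have "d dvd n" "d \<noteq> n" using that by (auto simp: Dv_def)
      thus "d < n" "d > 0" using less.prems by (auto dest: dvd_imp_le simp: dvd_pos_nat intro: Nat.gr0I)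
    qed
    hence "(\<Sum>d\<in>Dv n. int d * G d) = (\<Sum>d\<in>{n}. int d * G d)"
      using less.prems prime_gt_1_nat[OF p] by (intro sum.mono_neutral_right) (auto simp: Dv_def)
    thus ?case using sumG[OF less.prems] less.prems by simp
  qed
  thus ?thesis by (simp add: G_def R_def)
qed

theorem theorem1:
  fixes n :: nat
  assumes "n \<ge> 1"
  shows "(\<Sum>a \<in> prime_subfield - {0 :: 'a::finite_field}. int (card (S a n)))
           - (int CHAR('a) - 1) * int (card (S (0 :: 'a) n))
         = (if CHAR('a) dvd n
            then (\<Sum>a \<in> prime_subfield - {0 :: 'a}. int (card (S a (n div CHAR('a)))))
            else 0)"
proof -
  define p where "p = CHAR('a)"
  define A where "A = (\<lambda>n. \<Sum>a \<in> prime_subfield - {0 :: 'a}. int (card (S a n)))"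
  define B where "B = (\<lambda>n. int (card (monic_irreducibles n :: 'a poly set)))"
  have p_pos: "p > 0" by (simp add: p_def prime_gt_0_nat)
  have z: "0 \<in> (prime_subfield :: 'a set)" "0 \<in> (prime_subfield :: 'a alg_closure set)"
    by (auto simp: prime_subfield_def intro: range_eqI[of _ _ 0])
  have fin: "finite (prime_subfield :: 'a alg_closure set)"
    by (simp flip: image_to_ac_prime_subfield)
  have cp: "card (prime_subfield :: 'a alg_closure set) = p"
    using card_prime_subfield[where ?'b = "'a alg_closure"] by (simp add: p_def prime_gt_0_nat)
  have disj: "S a n \<inter> S b n = {}" if "a \<noteq> b" for a b :: 'a and n
    using that by (auto simp: S_def)
  have B: "B n = A n + int (card (S (0 :: 'a) n))" for n
  proof -
    have "B n = (\<Sum>a\<in>prime_subfield. int (card (S (a :: 'a) n)))"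
      unfolding B_def monic_irreducibles_eq_UN_S
      by (subst card_UN_disjoint) (auto simp: finite_S dest: disj)
    thus ?thesis unfolding A_def using z by (subst (asm) sum.remove[of _ 0]) auto
  qed
  \<comment> \<open>This indicator form matches the weight put into \<open>sum_poly_trace\<close>
    for \<open>sumA\<close>.\<close>
  have A: "A n = (\<Sum>f\<in>(monic_irreducibles n :: 'a poly set). if poly_trace f = 0 then 0 else 1)" for n
  proof -
    have sub: "S (0 :: 'a) n \<subseteq> monic_irreducibles n" by (auto simp: S_def)
    have "A n = B n - int (card (S (0 :: 'a) n))" using B by simp
    also have "\<dots> = int (card (monic_irreducibles n - S (0 :: 'a) n))"
      unfolding B_def using card_mono[OF finite_monic_irreducibles sub]
      by (subst card_Diff_subset[OF finite_S sub]) simp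
    also have "monic_irreducibles n - S (0 :: 'a) n = {f \<in> monic_irreducibles n. poly_trace f \<noteq> 0}"
      by (auto simp: S_def)
    also have "int (card \<dots>) = (\<Sum>f\<in>{f \<in> (monic_irreducibles n :: 'a poly set). poly_trace f \<noteq> 0}. 1)"
      by simp
    also have "\<dots> = (\<Sum>f\<in>(monic_irreducibles n :: 'a poly set). if poly_trace f = 0 then 0 else 1)"
      by (rule sum.mono_neutral_cong_left) (auto simp: finite_monic_irreducibles)
    finally show ?thesis .
  qed
  have sumB: "(\<Sum>d | d dvd n. int d * B d) = int CARD('a) ^ n" if "n > 0" for n
    using sum_poly_trace[OF that, of "\<lambda>_ :: 'a alg_closure. 1"] prime_gt_0_nat[of p]
    by (simp add: cp B_def p_def)
  have sumA: "int p * (\<Sum>d | d dvd n \<and> \<not> p dvd n div d. int d * A d)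
                = (int p - 1) * int CARD('a) ^ n" if n: "n > 0" for n
  proof -
    let ?W = "\<lambda>c :: 'a alg_closure. if c = 0 then 0 else 1 :: int"
    have "(\<Sum>c\<in>prime_subfield. ?W c) = int p - 1"
      using z(2) fin cp p_pos by (subst sum.remove[of _ 0]) (auto simp: of_nat_diff)
    \<comment> \<open>A multiple \<open>of_nat (n div d) * t\<close> is zero iff
      \<open>t = 0\<close> or \<open>p\<close> divides \<open>n div d\<close>, so divisors of the
      latter kind drop out.\<close>
    moreover have "(\<Sum>d | d dvd n. int d *
          (\<Sum>f\<in>(monic_irreducibles d :: 'a poly set). ?W (of_nat (n div d) * poly_trace f)))
        = (\<Sum>d | d dvd n. if p dvd n div d then 0 else int d * A d)"
      by (intro sum.cong refl) (auto simp: A p_def of_nat_eq_0_iff_char_dvd)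
    ultimately have "int p * (\<Sum>d | d dvd n. if p dvd n div d then 0 else int d * A d)
        = int CARD('a) ^ n * (int p - 1)"
      using sum_poly_trace[OF n, of ?W] by (simp add: p_def)
    also have "(\<Sum>d | d dvd n. if p dvd n div d then 0 else int d * A d)
        = (\<Sum>d | d dvd n \<and> \<not> p dvd n div d. int d * A d)"
      using n by (intro sum.mono_neutral_cong_right) auto
    finally show ?thesis by (simp add: mult.commute)
  qed
  have "prime p" by (simp add: p_def)
  from divisor_sum_recursion[OF this sumA sumB, of n]
  have "int p * A n - (int p - 1) * B n = (if p dvd n then A (n div p) else 0)"
    using assms by simp
  \<comment> \<open>With s the size of \<open>S 0 n\<close>, p A - (p - 1)(A + s) = A - (p - 1)
    s.\<close>
  thus ?thesis unfolding B p_def by (simp add: A_def algebra_simps)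
qed

end
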